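(* Let $\mathcal{P}$ be a monotone increasing (edge-monotone) graph property and $\mathcal{D}=\mathcal{D}_n$ a distribution on non-empty subsets of $E(K_n)$. Suppose $\mathcal{P}$ is $\omega$-edge-replaceable in the $\mathcal{D}$-process for some $\omega=\omega(n)\to\infty$. Then for any constants $0<\theta_1<\theta_2<1$, \[ m_{\mathcal{P}}(\theta_2,n)-m_{\mathcal{P}}(\theta_1,n)=O_{\theta_1,\theta_2}\!\left(\frac{m^*}{\omega}\right), \] where the implicit constant depends only on $\theta_1,\theta_2$. Consequently, $m^*$ is a sharp threshold of $\mathcal{P}$ in the $\mathcal{D}$-process.
   Context: The $\mathcal{D}$-process: the player starts with the empty graph $G_0$ on $[n]$ (unless another initial graph is specified). In each step $t\ge 1$, a subset $X_t\subseteq E(K_n)$ is sampled independently from $\mathcal{D}$; the player, knowing $G_{t-1}$ and $X_t$ (and the history), selects an edge $Y_t\in X_t$ (possibly randomly) and sets $G_t=G_{t-1}+Y_t$ (multigraphs allowed). A strategy $\mathcal{S}$ is a rule for these choices; $G^{\mathcal{S}}_t$ is the graph after $t$ steps and $T_{\mathcal{S}}$ is the least $t\ge1$ with $G^{\mathcal{S}}_t\in\mathcal{P}$ ($\infty$ if none). For $\theta\in(0,1)$, $m_{\mathcal{P}}(\theta,n)$ is the minimum $t\ge1$ such that some strategy $\mathcal{S}'$ has $\Pr[T_{\mathcal{S}'}\le t]\ge\theta$ and every strategy $\mathcal{S}$ has $\Pr[T_{\mathcal{S}}\le t-1]<\theta$; $m^*:=m_{\mathcal{P}}(1/2,n)$.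 $\mathcal{P}$ is $\omega$-edge-replaceable if for any $G\in\mathcal{P}$ and $e\in E(G)$, starting the $\mathcal{D}$-process from $G_0=G-e$, there is a strategy which constructs some $G'\in\mathcal{P}$ within $\sqrt{m^*}/\omega$ steps with probability at least $1-o(1/\sqrt{m^*})$. A function $s=s(n)$ is a sharp threshold for $\mathcal{P}$ in the $\mathcal{D}$-process if for every $\epsilon>0$: (1) there exists a strategy $\mathcal{S}'_n$ with $\Pr[T_{\mathcal{S}'_n}\le(1+\epsilon)s]=1-o(1)$, and (2) every strategy $\mathcal{S}_n$ satisfies $\Pr[T_{\mathcal{S}_n}\le(1-\epsilon)s]=o(1)$. Asymptotics are as $n\to\infty$. *)

theory Defs
  imports "HOL-Probability.Probability" "HOL-Library.Multiset" "HOL-Library.Extended_Nat"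
    "HOL-Library.Landau_Symbols"
begin

type_synonym edge = "nat set"
type_synonym multigraph = "edge multiset"

definition complete_edges :: "nat \<Rightarrow> edge set" where
  "complete_edges n = {e. e \<subseteq> {1..n} \<and> card e = 2}"

text \<open>A multigraph on the vertex set \<open>{1..n}\<close> is identified with its multiset of edges.\<close>

definition multigraphs :: "nat \<Rightarrow> multigraph set" where
  "multigraphs n = {G. set_mset G \<subseteq> complete_edges n}"

definition monotone_property :: "(nat \<Rightarrow> multigraph set) \<Rightarrow> bool" where
  "monotone_property P \<longleftrightarrow>
     (\<forall>n. P n \<subseteq> multigraphs n \<and>
          (\<forall>G\<in>P n. \<forall>H\<in>multigraphs n. G \<subseteq># H \<longrightarrow> H \<in> P n))"

text \<open>For \<open>n < 2\<close> there are no non-empty sets of edges, hence no such distribution.\<close>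

definition edge_set_distribution :: "(nat \<Rightarrow> edge set pmf) \<Rightarrow> bool" where
  "edge_set_distribution D \<longleftrightarrow>
     (\<forall>n\<ge>2. \<forall>X\<in>set_pmf (D n). X \<noteq> {} \<and> X \<subseteq> complete_edges n)"

text \<open>
  A round is a pair \<open>(X, Y)\<close> of the offered edge set and the selected edge.  Given the rounds
  played so far and the set offered next, a strategy returns the law of the next selected edge.
  The current graph is not a separate argument, since it is determined by the initial graph and
  the past rounds; strategies are always chosen after the initial graph.
\<close>

type_synonym round = "edge set \<times> edge"
type_synonym strategy = "round list \<Rightarrow> edge set \<Rightarrow> edge pmf"

definition strategies :: "nat \<Rightarrow> strategy set" where
  "strategies n = {S. \<forall>h X. X \<noteq> {} \<and> X \<subseteq> complete_edges n \<longrightarrow> set_pmf (S h X) \<subseteq> X}"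

text \<open>The law of the first \<open>t\<close> rounds, in chronological order.\<close>

primrec play :: "edge set pmf \<Rightarrow> strategy \<Rightarrow> nat \<Rightarrow> round list pmf" where
  "play D S 0 = return_pmf []"
| "play D S (Suc t) =
     bind_pmf (play D S t) (\<lambda>h.
       bind_pmf D (\<lambda>X.
         map_pmf (\<lambda>Y. h @ [(X, Y)]) (S h X)))"

definition graph_after :: "multigraph \<Rightarrow> round list \<Rightarrow> nat \<Rightarrow> multigraph" where
  "graph_after G0 h t = G0 + mset (map snd (take t h))"

text \<open>
  The least \<open>t \<ge> 1\<close> among the recorded rounds at which the graph lies in \<open>A\<close>, and
  \<open>\<infinity>\<close> (the infimum of the empty set) if there is none.
\<close>

definition hitting_time :: "multigraph set \<Rightarrow> multigraph \<Rightarrow> round list \<Rightarrow> enat" where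
  "hitting_time A G0 h =
     (INF t\<in>{t. 1 \<le> t \<and> t \<le> length h \<and> graph_after G0 h t \<in> A}. enat t)"

text \<open>
  The probability that \<open>T \<le> t\<close> when starting from the empty graph.  This event depends on the
  first \<open>t\<close> rounds only, so it is evaluated in the law of these.
\<close>

definition hit_prob :: "edge set pmf \<Rightarrow> strategy \<Rightarrow> multigraph set \<Rightarrow> nat \<Rightarrow> real" where
  "hit_prob D S A t = measure_pmf.prob (play D S t) {h. hitting_time A {#} h \<le> enat t}"

definition is_threshold_time ::
    "(nat \<Rightarrow> multigraph set) \<Rightarrow> (nat \<Rightarrow> edge set pmf) \<Rightarrow> real \<Rightarrow> nat \<Rightarrow> nat \<Rightarrow> bool" where
  "is_threshold_time P D \<theta> n t \<longleftrightarrow>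
     t \<ge> 1 \<and>
     (\<exists>S\<in>strategies n. hit_prob (D n) S (P n) t \<ge> \<theta>) \<and>
     (\<forall>S\<in>strategies n. hit_prob (D n) S (P n) (t - 1) < \<theta>)"

text \<open>
  The number \<open>m_P(\<theta>, n)\<close>.  It is meaningful only if some \<open>t\<close> qualifies; for a monotone property
  and \<open>0 < \<theta> < 1\<close> this does not depend on \<open>\<theta>\<close>, as it just says that the property can be reached
  with positive probability.
\<close>

definition threshold_time ::
    "(nat \<Rightarrow> multigraph set) \<Rightarrow> (nat \<Rightarrow> edge set pmf) \<Rightarrow> real \<Rightarrow> nat \<Rightarrow> nat" where
  "threshold_time P D \<theta> n = (LEAST t. is_threshold_time P D \<theta> n t)"

abbreviation median_time ::
    "(nat \<Rightarrow> multigraph set) \<Rightarrow> (nat \<Rightarrow> edge set pmf) \<Rightarrow> nat \<Rightarrow> nat" where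
  "median_time P D n \<equiv> threshold_time P D (1/2) n"

text \<open>
  The probability that the process started from \<open>G0\<close> constructs a member of \<open>A\<close> within \<open>t\<close> steps.
  Unlike in \<open>hitting_time\<close>, step \<open>0\<close> counts: nothing has to be done if \<open>G0\<close> is in \<open>A\<close> already.
\<close>

definition construct_prob ::
    "edge set pmf \<Rightarrow> strategy \<Rightarrow> multigraph set \<Rightarrow> multigraph \<Rightarrow> nat \<Rightarrow> real" where
  "construct_prob D S A G0 t =
     measure_pmf.prob (play D S t) {h. \<exists>i\<le>t. graph_after G0 h i \<in> A}"

text \<open>The error term \<open>\<delta>\<close> is uniform in \<open>G\<close> and \<open>e\<close>; \<open>G - e\<close> deletes one copy of \<open>e\<close>.\<close>

definition edge_replaceable ::
    "(nat \<Rightarrow> multigraph set) \<Rightarrow> (nat \<Rightarrow> edge set pmf) \<Rightarrow> (nat \<Rightarrow> real) \<Rightarrow> bool" where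
  "edge_replaceable P D \<omega> \<longleftrightarrow>
     (\<exists>\<delta> :: nat \<Rightarrow> real.
        \<delta> \<in> o(\<lambda>n. 1 / sqrt (real (median_time P D n))) \<and>
        (\<forall>\<^sub>F n in sequentially. \<forall>G\<in>P n. \<forall>e\<in>set_mset G. \<exists>S\<in>strategies n.
           construct_prob (D n) S (P n) (G - {#e#})
             (nat \<lfloor>sqrt (real (median_time P D n)) / \<omega> n\<rfloor>) \<ge> 1 - \<delta> n))"

text \<open>
  As \<open>T\<close> is integer valued and at least \<open>1\<close>, \<open>T \<le> x\<close> is the same as \<open>T \<le> nat \<lfloor>x\<rfloor>\<close> for real \<open>x\<close>,
  also for negative \<open>x\<close>.
\<close>

definition sharp_threshold ::
    "(nat \<Rightarrow> multigraph set) \<Rightarrow> (nat \<Rightarrow> edge set pmf) \<Rightarrow> (nat \<Rightarrow> real) \<Rightarrow> bool" where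
  "sharp_threshold P D s \<longleftrightarrow>
     (\<forall>\<epsilon>>0.
        (\<exists>S. (\<forall>n. S n \<in> strategies n) \<and>
             (\<lambda>n. hit_prob (D n) (S n) (P n) (nat \<lfloor>(1 + \<epsilon>) * s n\<rfloor>)) \<longlonglongrightarrow> 1) \<and>
        (\<forall>S. (\<forall>n. S n \<in> strategies n) \<longrightarrow>
             (\<lambda>n. hit_prob (D n) (S n) (P n) (nat \<lfloor>(1 - \<epsilon>) * s n\<rfloor>)) \<longlonglongrightarrow> 0))"

end

theory Submission
  imports Defs
begin

text \<open>
  Let \<open>w\<close> be the probability that optimal play reaches the property within the \<open>r\<close> steps left.  As
  long as no step changes \<open>w\<close> by more than a factor \<open>1 \<plusminus> L\<close>, the expected decrease of \<open>ln w\<close> per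
  step is only \<open>O(L\<^sup>2)\<close>.  So let the player keep a fictional graph besides the real one: when the
  edge to be added would make \<open>w\<close> drop by more, or when some edge would make it rise by more, the
  player pretends to add the best edge of all instead, whether or not it is offered.  The fictional
  graph always ends up in the property, and \<open>(2 / L) (2 L\<^sup>2 r - ln w)\<close> bounds the expected number of
  pretended edges.  With \<open>L\<close> of order \<open>1 / sqrt m\<^sup>*\<close> this is \<open>O(sqrt m\<^sup>*)\<close>; by Markov's inequality
  \<open>k = O(sqrt m\<^sup>*)\<close> replacements, taking \<open>sqrt m\<^sup>* / \<omega>\<close> steps and failing with probability
  \<open>o(1 / sqrt m\<^sup>*)\<close> each, then turn the real graph into one with the property.
\<close>

section \<open>Expectations under laws of finite support\<close>

lemma expectation_mono_finite:
  fixes f g :: "'a \<Rightarrow> real"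
  assumes "finite (set_pmf p)" "\<And>x. x \<in> set_pmf p \<Longrightarrow> f x \<le> g x"
  shows "measure_pmf.expectation p f \<le> measure_pmf.expectation p g"
  using assms by (intro integral_mono_AE integrable_measure_pmf_finite) (auto simp: AE_measure_pmf_iff)

lemma expectation_cong_pmf:
  fixes f g :: "'a \<Rightarrow> real"
  assumes "\<And>x. x \<in> set_pmf p \<Longrightarrow> f x = g x"
  shows "measure_pmf.expectation p f = measure_pmf.expectation p g"
  using assms by (intro integral_cong_AE) (auto simp: AE_measure_pmf_iff)

lemma expectation_affine_finite:
  fixes f :: "'a \<Rightarrow> real"
  assumes "finite (set_pmf p)"
  shows "measure_pmf.expectation p (\<lambda>x. a + b * f x) = a + b * measure_pmf.expectation p f"
  using integrable_measure_pmf_finite[OF assms, of f] by simp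

lemma expectation_bind_finite:
  fixes h :: "'b \<Rightarrow> real"
  assumes "finite (set_pmf p)" "\<And>x. x \<in> set_pmf p \<Longrightarrow> finite (set_pmf (f x))"
  shows "measure_pmf.expectation (bind_pmf p f) h =
    measure_pmf.expectation p (\<lambda>x. measure_pmf.expectation (f x) h)"
proof -
  have "measure_pmf.expectation p (\<lambda>x. measure_pmf.expectation (f x) h)
      = (\<Sum>a\<in>set_pmf p. measure_pmf.expectation (f a) h * pmf p a)"
    by (rule integral_measure_pmf_real) (use assms in auto)
  then show ?thesis
    using assms by (subst pmf_expectation_bind[of "set_pmf p"]) (auto simp: mult.commute)
qed

section \<open>The value of optimal play, for abstract edges\<close>

locale edge_game =
  fixes E :: "'e set" and D :: "'e set pmf" and A :: "'e multiset set"
  assumes finite_E: "finite E"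
    and offers: "X \<in> set_pmf D \<Longrightarrow> X \<noteq> {} \<and> X \<subseteq> E"
    and A_edges: "G \<in> A \<Longrightarrow> set_mset G \<subseteq> E"
    and A_upward: "G \<in> A \<Longrightarrow> G \<subseteq># H \<Longrightarrow> set_mset H \<subseteq> E \<Longrightarrow> H \<in> A"
begin

text \<open>The Bellman recursion in the number of steps left. Membership is tested only at the end,
  which loses nothing because \<open>A\<close> is closed upwards.\<close>

primrec reach_prob :: "nat \<Rightarrow> 'e multiset \<Rightarrow> real" where
  "reach_prob 0 G = (if G \<in> A then 1 else 0)"
| "reach_prob (Suc r) G =
     measure_pmf.expectation D (\<lambda>X. MAX e\<in>X. reach_prob r (add_mset e G))"

lemma finite_support: "finite (set_pmf D)"
  by (rule finite_subset[of _ "Pow E"]) (use offers finite_E in auto)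

lemma finite_offer: "X \<in> set_pmf D \<Longrightarrow> finite X"
  using offers finite_E finite_subset by blast

text \<open>Lower bounds on optimal play come from here: it suffices to name one edge per offer, and
  no strategy has to be built.\<close>

lemma reach_prob_Suc_ge:
  assumes "\<And>X. X \<in> set_pmf D \<Longrightarrow> \<exists>e\<in>X. g X \<le> reach_prob r (add_mset e G)"
  shows "measure_pmf.expectation D g \<le> reach_prob (Suc r) G"
  unfolding reach_prob.simps
proof (rule expectation_mono_finite[OF finite_support])
  fix X assume X: "X \<in> set_pmf D"
  then obtain e where "e \<in> X" "g X \<le> reach_prob r (add_mset e G)"
    using assms by blast
  then show "g X \<le> (MAX e\<in>X. reach_prob r (add_mset e G))"
    using finite_offer[OF X] by (meson Max_ge finite_imageI image_eqI order_trans)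
qed

lemma reach_prob_Suc_le:
  assumes "\<And>X e. X \<in> set_pmf D \<Longrightarrow> e \<in> X \<Longrightarrow> reach_prob r (add_mset e G) \<le> g X"
  shows "reach_prob (Suc r) G \<le> measure_pmf.expectation D g"
  unfolding reach_prob.simps
proof (rule expectation_mono_finite[OF finite_support])
  fix X assume X: "X \<in> set_pmf D"
  show "(MAX e\<in>X. reach_prob r (add_mset e G)) \<le> g X"
    using finite_offer[OF X] offers[OF X] assms[OF X] by (intro Max.boundedI) auto
qed

lemma reach_prob_nonneg: "0 \<le> reach_prob r G"
proof (induction r arbitrary: G)
  case (Suc r)
  then show ?case
    using reach_prob_Suc_ge[of "\<lambda>_. 0" r G] offers by fastforce
qed simp

lemma reach_prob_le_1: "reach_prob r G \<le> 1"
proof (induction r arbitrary: G)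
  case (Suc r)
  then show ?case
    using reach_prob_Suc_le[of r G "\<lambda>_. 1"] by simp
qed simp

lemma reach_prob_member:
  assumes "G \<in> A"
  shows "reach_prob r G = 1"
  using assms
proof (induction r arbitrary: G)
  case (Suc r)
  have "add_mset e G \<in> A" if "X \<in> set_pmf D" "e \<in> X" for X e
    using A_upward[OF Suc.prems, of "add_mset e G"] A_edges[OF Suc.prems] offers[OF that(1)] that by auto
  then have "reach_prob r (add_mset e G) = 1" if "X \<in> set_pmf D" "e \<in> X" for X e
    using Suc.IH that by blast
  then have "1 \<le> reach_prob (Suc r) G"
    using reach_prob_Suc_ge[of "\<lambda>_. 1" r G] offers by fastforce
  then show ?case
    using reach_prob_le_1 antisym by blast
qed simp

lemma add_mset_edges:
  "set_mset G \<subseteq> E \<Longrightarrow> X \<in> set_pmf D \<Longrightarrow> e \<in> X \<Longrightarrow> set_mset (add_mset e G) \<subseteq> E"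
  using offers by auto

text \<open>The choices that are best for \<open>r\<close> steps can be copied with more time left;
  once in \<open>A\<close>, the graph stays there.\<close>

lemma reach_prob_mono_time:
  assumes "r \<le> r'" "set_mset G \<subseteq> E"
  shows "reach_prob r G \<le> reach_prob r' G"
  using assms
proof (induction r arbitrary: r' G)
  case 0
  then show ?case
    by (auto simp: reach_prob_member reach_prob_nonneg)
next
  case (Suc r)
  then obtain q where q: "r' = Suc q" "r \<le> q"
    by (cases r') auto
  have "\<exists>e\<in>X. (MAX e\<in>X. reach_prob r (add_mset e G)) \<le> reach_prob q (add_mset e G)"
    if X: "X \<in> set_pmf D" for X
  proof -
    have "(MAX e\<in>X. reach_prob r (add_mset e G)) \<in> (\<lambda>e. reach_prob r (add_mset e G)) ` X"
      using finite_offer[OF X] offers[OF X] by (intro Max_in) auto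
    then obtain e where e: "e \<in> X"
      "(MAX e\<in>X. reach_prob r (add_mset e G)) = reach_prob r (add_mset e G)"
      by auto
    then show ?thesis
      using Suc.IH[OF q(2) add_mset_edges[OF Suc.prems(2) X e(1)]] by (intro bexI[of _ e]) auto
  qed
  then show ?case
    unfolding q by (subst reach_prob.simps(2)) (rule reach_prob_Suc_ge)
qed

text \<open>Phases of a strategy are concatenated: while the first phase is being played from \<open>R\<close>, it
  is imagined to be played from a graph that \<open>R\<close> contains up to the missing edges \<open>M\<close>.\<close>

lemma reach_prob_then:
  assumes second: "\<And>F R. F \<in> A \<Longrightarrow> F \<subseteq># R + M \<Longrightarrow> set_mset R \<subseteq> E \<Longrightarrow> 1 - c \<le> reach_prob s R"
    and "0 \<le> c" "G \<subseteq># R + M" "set_mset R \<subseteq> E"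
  shows "reach_prob r G - c \<le> reach_prob (r + s) R"
  using assms(3,4)
proof (induction r arbitrary: G R)
  case 0
  then show ?case
    using second[of G R] \<open>0 \<le> c\<close> reach_prob_nonneg[of s R] by auto
next
  case (Suc r)
  \<comment> \<open>The edge that is best from \<open>G\<close> is added to both graphs, so
    \<open>M\<close> still covers the difference. The factor \<open>1\<close> gives the bound the
    shape of \<open>expectation_affine_finite\<close>.\<close>
  have "\<exists>e\<in>X. - c + 1 * (MAX e\<in>X. reach_prob r (add_mset e G)) \<le> reach_prob (r + s) (add_mset e R)"
    if X: "X \<in> set_pmf D" for X
  proof -
    have "(MAX e\<in>X. reach_prob r (add_mset e G)) \<in> (\<lambda>e. reach_prob r (add_mset e G)) ` X"
      using finite_offer[OF X] offers[OF X] by (intro Max_in) auto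
    then obtain e where e: "e \<in> X"
      "(MAX e\<in>X. reach_prob r (add_mset e G)) = reach_prob r (add_mset e G)"
      by auto
    have "reach_prob r (add_mset e G) - c \<le> reach_prob (r + s) (add_mset e R)"
      using Suc.prems by (intro Suc.IH add_mset_edges[OF _ X e(1)]) auto
    then show ?thesis
      using e by (intro bexI[of _ e]) auto
  qed
  from reach_prob_Suc_ge[OF this] show ?case
    by (simp only: expectation_affine_finite[OF finite_support] add_Suc reach_prob.simps(2))
       (simp add: algebra_simps)
qed

text \<open>The missing edges are replaced one at a time: for \<open>e\<close> in \<open>M\<close>,
  the replacing play is imagined from \<open>F - {#e#}\<close>, which \<open>R\<close> contains up
  to the rest of \<open>M\<close>. Each replacement takes \<open>K\<close> steps and costs
  \<open>\<delta>\<close>.\<close>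

lemma reach_prob_repair:
  assumes replace: "\<And>G e. G \<in> A \<Longrightarrow> e \<in># G \<Longrightarrow> 1 - \<delta> \<le> reach_prob K (G - {#e#})"
    and "0 \<le> \<delta>" "F \<in> A" "F \<subseteq># R + M" "set_mset R \<subseteq> E" "size M \<le> k"
  shows "1 - real k * \<delta> \<le> reach_prob (K * k) R"
  using assms(3-6)
proof (induction k arbitrary: F R M)
  case 0
  then show ?case
    using A_upward reach_prob_member by auto
next
  case (Suc k)
  show ?case
  proof (cases M)
    case empty
    then have "R \<in> A"
      using Suc.prems A_upward by auto
    then show ?thesis
      using \<open>0 \<le> \<delta>\<close> reach_prob_member by simp
  next
    case (add e M')
    have "size M' \<le> k"
      using Suc.prems add by simp
    have "1 - \<delta> \<le> reach_prob K (F - {#e#})"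
    \<comment> \<open>A pretended edge need not occur in \<open>F\<close>; then
      \<open>F - {#e#}\<close> is \<open>F\<close> itself and already has the property.\<close>
    proof (cases "e \<in># F")
      case False
      then show ?thesis
        using reach_prob_member[OF \<open>F \<in> A\<close>] \<open>0 \<le> \<delta>\<close> by simp
    qed (use replace \<open>F \<in> A\<close> in auto)
    moreover have "reach_prob K (F - {#e#}) - real k * \<delta> \<le> reach_prob (K + K * k) R"
    proof (rule reach_prob_then[where M = M'])
      show "F - {#e#} \<subseteq># R + M'"
        using Suc.prems(2) add by (simp add: subset_eq_diff_conv)
      show "1 - real k * \<delta> \<le> reach_prob (K * k) R'" if "F' \<in> A" "F' \<subseteq># R' + M'" "set_mset R' \<subseteq> E" for F' R'
        by (rule Suc.IH[OF that \<open>size M' \<le> k\<close>])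
    qed (use \<open>0 \<le> \<delta>\<close> Suc.prems in auto)
    ultimately show ?thesis
      by (simp add: algebra_simps)
  qed
qed

section \<open>The potential that pays for pretended edges\<close>

text \<open>Every step releases \<open>2 * L\<^sup>2\<close> for the second-order loss of
  \<open>ln\<close>, and the factor \<open>2 / L\<close> makes a gain of \<open>L / 2\<close> worth
  one pretended edge. The next three lemmas treat the three kinds of steps.\<close>

definition tamper_budget :: "real \<Rightarrow> nat \<Rightarrow> real \<Rightarrow> real" where
  "tamper_budget L r w = 2 / L * (2 * L\<^sup>2 * real r - ln w)"

text \<open>Pretending an edge that raises the chance by a factor \<open>1 + L\<close> pays for
  itself, as \<open>ln (1 + L)\<close> is at least \<open>L - L\<^sup>2\<close>.\<close>

lemma tamper_budget_raise:
  assumes "0 < L" "L \<le> 1/2" "0 < w" "(1 + L) * w \<le> u"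
  shows "1 + tamper_budget L r u \<le> tamper_budget L (Suc r) w"
proof -
  have "ln ((1 + L) * w) \<le> ln u"
    using assms by (intro ln_mono) auto
  then have "ln (1 + L) + ln w \<le> ln u"
    using assms by (simp add: ln_mult)
  moreover have "L - L\<^sup>2 \<le> ln (1 + L)"
    using assms by (intro ln_one_plus_pos_lower_bound) auto
  moreover have "L * L \<le> L * (1/2)"
    using assms by (intro mult_left_mono) auto
  ultimately have "L / 2 \<le> ln u - ln w + 2 * L\<^sup>2"
    using zero_le_power2[of L] unfolding power2_eq_square by linarith
  then have "2 / L * (L / 2) \<le> 2 / L * (ln u - ln w + 2 * L\<^sup>2)"
    using assms by (intro mult_left_mono) auto
  then show ?thesis
    using assms by (simp add: tamper_budget_def algebra_simps)
qed

text \<open>For a small relative change \<open>y\<close>, \<open>ln (1 + y)\<close> differs from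
  \<open>y\<close> by at most \<open>2 * L\<^sup>2\<close>. The linear term is kept in the bound
  because it averages to zero over the offers.\<close>

lemma tamper_budget_keep:
  assumes "0 < L" "L \<le> 1/2" "0 < w" "\<bar>u / w - 1\<bar> \<le> L"
  shows "tamper_budget L r u \<le> tamper_budget L (Suc r) w - 2 / L * (u / w - 1)"
proof -
  define y where "y = u / w - 1"
  have y: "\<bar>y\<bar> \<le> L" and u: "u = (1 + y) * w"
    using assms by (auto simp: y_def)
  have "\<bar>ln (1 + y) - y\<bar> \<le> 2 * y\<^sup>2"
    using y assms by (intro abs_ln_one_plus_x_minus_x_bound) auto
  moreover have "y\<^sup>2 \<le> L\<^sup>2"
    using y by (metis abs_ge_zero power2_abs power_mono)
  moreover have "ln u = ln (1 + y) + ln w"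
    unfolding u using assms y by (subst ln_mult) auto
  ultimately have "y \<le> ln u - ln w + 2 * L\<^sup>2"
    by linarith
  then have "2 / L * y \<le> 2 / L * (ln u - ln w + 2 * L\<^sup>2)"
    using assms by (intro mult_left_mono) auto
  then show ?thesis
    unfolding y_def[symmetric] using assms by (simp add: tamper_budget_def algebra_simps)
qed

text \<open>Avoiding a relative drop \<open>y < - L\<close> costs one pretended edge, but the linear
  term still credits the drop itself, which is worth more than 2.\<close>

lemma tamper_budget_avoid:
  assumes "0 < L" "0 < w" "w \<le> u" "y < - L"
  shows "1 + tamper_budget L r u \<le> tamper_budget L (Suc r) w - 2 / L * y"
proof -
  have "ln w \<le> ln u"
    using assms by simp
  then have "L / 2 \<le> ln u - ln w + 2 * L\<^sup>2 - y"
    using assms zero_le_power2[of L] by linarith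
  then have "2 / L * (L / 2) \<le> 2 / L * (ln u - ln w + 2 * L\<^sup>2 - y)"
    using assms by (intro mult_left_mono) auto
  then show ?thesis
    using assms by (simp add: tamper_budget_def algebra_simps add_divide_distrib)
qed

text \<open>\<open>F\<close> is the fictional graph, \<open>R\<close> the real one, and \<open>M\<close> consists of the edges pretended so far.\<close>

lemma reach_prob_tamper:
  assumes second: "\<And>F R M. F \<in> A \<Longrightarrow> F \<subseteq># R + M \<Longrightarrow> set_mset R \<subseteq> E \<Longrightarrow> size M \<le> k \<Longrightarrow>
      1 - c \<le> reach_prob s R"
    and "0 \<le> c" "0 < L" "L \<le> 1/2"
    and "0 < reach_prob r F" "F \<subseteq># R + M" "set_mset R \<subseteq> E"
  shows "1 - c - (real (size M) + tamper_budget L r (reach_prob r F)) / (real k + 1)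
    \<le> reach_prob (r + s) R"
  using assms(5-7)
proof (induction r arbitrary: F R M)
  case 0
  \<comment> \<open>The chance is now 1, so the budget is 0 and only \<open>size M\<close>
    counts.\<close>
  then have "F \<in> A"
    by (auto split: if_splits)
  show ?case
  proof (cases "size M \<le> k")
    case True
    then have "1 - c \<le> reach_prob s R"
      using second \<open>F \<in> A\<close> 0 by blast
    moreover have "0 \<le> real (size M) / (real k + 1)"
      by simp
    ultimately have "1 - c - real (size M) / (real k + 1) \<le> reach_prob s R"
      by linarith
    then show ?thesis
      using \<open>F \<in> A\<close> by (simp add: tamper_budget_def)
  next
    \<comment> \<open>Markov's inequality is built into the induction: with more than
      \<open>k\<close> pretended edges the penalty is at least 1 and the bound is trivial.\<close>
    case False
    then have "1 \<le> real (size M) / (real k + 1)"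
      by simp
    then have "1 - c - real (size M) / (real k + 1) \<le> reach_prob s R"
      using \<open>0 \<le> c\<close> reach_prob_nonneg[of s R] by linarith
    then show ?thesis
      using \<open>F \<in> A\<close> by (simp add: tamper_budget_def)
  qed
next
  case (Suc r)
  define w where "w = reach_prob (Suc r) F"
  define v where "v X = (MAX e\<in>X. reach_prob r (add_mset e F))" for X
  have "0 < w" and w_def': "w = measure_pmf.expectation D v"
    using Suc.prems(1) unfolding w_def v_def by simp_all
  obtain X0 where "X0 \<in> set_pmf D"
    using set_pmf_not_empty[of D] by blast
  then have "E \<noteq> {}"
    using offers by blast
  \<comment> \<open>\<open>top\<close> is what is achieved by pretending the best edge \<open>e'\<close> while any offered edge is added.\<close>
  define top where "top = (MAX e\<in>E. reach_prob r (add_mset e F))"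
  have "top \<in> (\<lambda>e. reach_prob r (add_mset e F)) ` E"
    unfolding top_def using finite_E \<open>E \<noteq> {}\<close> by (intro Max_in) auto
  then obtain e' where e': "top = reach_prob r (add_mset e' F)" "e' \<in> E"
    by blast
  have le_top: "reach_prob r (add_mset e F) \<le> top" if "e \<in> E" for e
    unfolding top_def using finite_E that by (intro Max_ge) auto
  have "reach_prob (Suc r) F \<le> measure_pmf.expectation D (\<lambda>_. top)"
    using le_top offers by (intro reach_prob_Suc_le) blast
  then have "w \<le> top"
    by (simp add: w_def del: reach_prob.simps)
  have tampered: "1 - c - (real (size M) + 1 + tamper_budget L r top) / (real k + 1)
      \<le> reach_prob (r + s) (add_mset e R)" if "X \<in> set_pmf D" "e \<in> X" for X e
  proof -
    have "add_mset e' F \<subseteq># add_mset e R + add_mset e' M"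
      using subset_mset.order_trans[OF Suc.prems(2), of "add_mset e (R + M)"] by simp
    then show ?thesis
      using Suc.IH[of "add_mset e' F" "add_mset e R" "add_mset e' M"] e' \<open>w \<le> top\<close> \<open>0 < w\<close>
        add_mset_edges[OF Suc.prems(3) that] by (simp add: algebra_simps)
  qed
  \<comment> \<open>What the induction hypothesis guarantees after offer \<open>X\<close>. It is
    affine in \<open>v X\<close>, and since \<open>w\<close> is the mean of \<open>v\<close>, the
    term with \<open>v X / w - 1\<close> vanishes in expectation.\<close>
  define g where "g X = 1 - c - (real (size M) + tamper_budget L (Suc r) w - 2 / L * (v X / w - 1)) / (real k + 1)" for X
  \<comment> \<open>If some edge could raise the chance by a factor \<open>1 + L\<close>,
    \<open>e'\<close> is pretended whatever is offered. Otherwise every offer has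
    \<open>v X / w - 1 \<le> L\<close>, and \<open>e'\<close> is pretended only on a drop below
    \<open>1 - L\<close>.\<close>
  show ?case
  proof (cases "(1 + L) * w \<le> top")
    case True
    have "measure_pmf.expectation D (\<lambda>_. 1 - c - (real (size M) + tamper_budget L (Suc r) w) / (real k + 1))
      \<le> reach_prob (Suc (r + s)) R"
    proof (rule reach_prob_Suc_ge)
      fix X assume X: "X \<in> set_pmf D"
      then obtain e where "e \<in> X"
        using offers by blast
      have "(real (size M) + 1 + tamper_budget L r top) / (real k + 1)
          \<le> (real (size M) + tamper_budget L (Suc r) w) / (real k + 1)"
        using tamper_budget_raise[OF \<open>0 < L\<close> \<open>L \<le> 1/2\<close> \<open>0 < w\<close> True, of r] by (intro divide_right_mono) auto
      then show "\<exists>e\<in>X. 1 - c - (real (size M) + tamper_budget L (Suc r) w) / (real k + 1)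
          \<le> reach_prob (r + s) (add_mset e R)"
        using tampered[OF X \<open>e \<in> X\<close>] \<open>e \<in> X\<close> by (intro bexI[of _ e]) auto
    qed
    then show ?thesis
      by (simp add: w_def)
  next
    case False
    have "measure_pmf.expectation D g \<le> reach_prob (Suc (r + s)) R"
    proof (rule reach_prob_Suc_ge)
      fix X assume X: "X \<in> set_pmf D"
      have "v X \<in> (\<lambda>e. reach_prob r (add_mset e F)) ` X"
        unfolding v_def using finite_offer[OF X] offers[OF X] by (intro Max_in) auto
      then obtain e where e: "e \<in> X" "v X = reach_prob r (add_mset e F)"
        by blast
      have "v X \<le> top"
        using e le_top offers[OF X] by auto
      with False have "v X / w - 1 \<le> L"
        using \<open>0 < w\<close> by (simp add: field_simps)
      show "\<exists>e\<in>X. g X \<le> reach_prob (r + s) (add_mset e R)"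
      proof (cases "v X / w - 1 < - L")
        case True
        have "(real (size M) + 1 + tamper_budget L r top) / (real k + 1)
          \<le> (real (size M) + tamper_budget L (Suc r) w - 2 / L * (v X / w - 1)) / (real k + 1)"
          using tamper_budget_avoid[OF \<open>0 < L\<close> \<open>0 < w\<close> \<open>w \<le> top\<close> True, of r] by (intro divide_right_mono) auto
        then show ?thesis
          using tampered[OF X e(1)] e(1) unfolding g_def by (intro bexI[of _ e]) auto
      next
        case False
        with \<open>v X / w - 1 \<le> L\<close> have "\<bar>v X / w - 1\<bar> \<le> L"
          by simp
        from tamper_budget_keep[OF \<open>0 < L\<close> \<open>L \<le> 1/2\<close> \<open>0 < w\<close> this, of r]
        have "(real (size M) + tamper_budget L r (v X)) / (real k + 1)
          \<le> (real (size M) + tamper_budget L (Suc r) w - 2 / L * (v X / w - 1)) / (real k + 1)"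
          by (intro divide_right_mono) auto
        \<comment> \<open>The induction hypothesis needs a positive chance; a relative drop of at
          most \<open>L \<le> 1/2\<close> leaves one.\<close>
        moreover have "0 < v X / w"
          using False \<open>L \<le> 1/2\<close> by linarith
        then have "0 < v X"
          using \<open>0 < w\<close> by (simp add: zero_less_divide_iff)
        then have "1 - c - (real (size M) + tamper_budget L r (v X)) / (real k + 1)
            \<le> reach_prob (r + s) (add_mset e R)"
          using Suc.IH[of "add_mset e F" "add_mset e R" M] e Suc.prems(2)
            add_mset_edges[OF Suc.prems(3) X e(1)] by simp
        ultimately show ?thesis
          using e(1) unfolding g_def by (intro bexI[of _ e]) auto
      qed
    qed
    moreover have "g = (\<lambda>X. 1 - c - (real (size M) + tamper_budget L (Suc r) w + 2 / L) / (real k + 1)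
        + 2 / L / w / (real k + 1) * v X)"
      by (simp add: g_def fun_eq_iff diff_divide_distrib add_divide_distrib right_diff_distrib)
    then have "measure_pmf.expectation D g = 1 - c - (real (size M) + tamper_budget L (Suc r) w + 2 / L) / (real k + 1)
        + 2 / L / w / (real k + 1) * w"
      by (simp only: expectation_affine_finite[OF finite_support] w_def'[symmetric])
    ultimately show ?thesis
      using \<open>0 < w\<close> by (simp add: w_def[symmetric] add_divide_distrib del: reach_prob.simps)
  qed
qed

end

section \<open>Recorded rounds and hitting times\<close>

lemma play_rounds:
  assumes "S \<in> strategies n" "\<And>X. X \<in> set_pmf D \<Longrightarrow> X \<noteq> {} \<and> X \<subseteq> complete_edges n"
    "h \<in> set_pmf (play D S t)"
  shows "length h = t \<and> set (map snd h) \<subseteq> complete_edges n"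
  using assms(3)
proof (induction t arbitrary: h)
  case (Suc t)
  then obtain h' X Y where h: "h' \<in> set_pmf (play D S t)" "X \<in> set_pmf D" "Y \<in> set_pmf (S h' X)"
    "h = h' @ [(X, Y)]"
    by auto
  have "set_pmf (S h' X) \<subseteq> X"
    using assms(1) assms(2)[OF h(2)] by (auto simp: strategies_def)
  then show ?case
    using Suc.IH[OF h(1)] h assms(2)[OF h(2)] by auto
qed simp

text \<open>The infimum over a non-empty set of naturals is attained, and over the empty set it is
  infinite, hence above every \<open>enat t\<close>.\<close>

lemma hitting_time_le_iff:
  "hitting_time A G h \<le> enat t \<longleftrightarrow>
    (\<exists>i. 1 \<le> i \<and> i \<le> length h \<and> i \<le> t \<and> graph_after G h i \<in> A)" (is "?l \<longleftrightarrow> ?r")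
proof
  let ?T = "{i. 1 \<le> i \<and> i \<le> length h \<and> graph_after G h i \<in> A}"
  assume l: ?l
  show ?r
  proof (cases "?T = {}")
    case True
    then show ?thesis
      using l unfolding hitting_time_def True by (simp add: top_enat_def)
  next
    case False
    then obtain i where "enat i \<in> enat ` ?T"
      by blast
    then have "(LEAST x. x \<in> enat ` ?T) \<in> enat ` ?T"
      by (rule LeastI)
    then have "(INF i\<in>?T. enat i) \<in> enat ` ?T"
      using False by (simp only: Inf_enat_def image_is_empty if_False)
    then obtain j where "j \<in> ?T" "(INF i\<in>?T. enat i) = enat j"
      by blast
    then show ?thesis
      using l unfolding hitting_time_def by (intro exI[of _ j]) simp
  qed
next
  assume ?r
  then obtain i where i: "1 \<le> i" "i \<le> length h" "i \<le> t" "graph_after G h i \<in> A"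
    by blast
  then have "hitting_time A G h \<le> enat i"
    unfolding hitting_time_def by (intro INF_lower) auto
  then show ?l
    using i(3) by (meson enat_ord_simps(1) order_trans)
qed

section \<open>Strategies compared with the value of optimal play\<close>

locale graph_game = edge_game "complete_edges n" D A
  for n :: nat and D :: "edge set pmf" and A :: "multigraph set"
begin

lemma finite_play:
  assumes "S \<in> strategies n"
  shows "finite (set_pmf (play D S t))"
proof (induction t)
  case (Suc t)
  have "finite (set_pmf (S h X))" if "X \<in> set_pmf D" for h X
  proof (rule finite_subset)
    show "set_pmf (S h X) \<subseteq> X"
      using assms offers[OF that] by (auto simp: strategies_def)
  qed (rule finite_offer[OF that])
  then show ?case
    using Suc finite_support by auto
qed simp

definition graph_of :: "multigraph \<Rightarrow> round list \<Rightarrow> multigraph" where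
  "graph_of G h = G + mset (map snd h)"

text \<open>The expected value of \<open>reach_prob\<close> after \<open>s\<close> of \<open>t\<close> rounds is a supermartingale under every
  strategy and constant under the greedy one, which is how the two are compared.\<close>

definition chance :: "strategy \<Rightarrow> multigraph \<Rightarrow> nat \<Rightarrow> nat \<Rightarrow> real" where
  "chance S G t s = measure_pmf.expectation (play D S s) (\<lambda>h. reach_prob (t - s) (graph_of G h))"

lemma chance_0: "chance S G t 0 = reach_prob t G"
  by (simp add: chance_def graph_of_def)

lemma chance_end: "chance S G t t = measure_pmf.prob (play D S t) {h. graph_of G h \<in> A}"
proof -
  have "reach_prob 0 (graph_of G h) = indicator {h. graph_of G h \<in> A} h" for h
    by simp
  then show ?thesis
    by (simp add: chance_def)
qed

lemma chance_Suc:
  assumes "S \<in> strategies n"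
  shows "chance S G t (Suc s) = measure_pmf.expectation (play D S s) (\<lambda>h.
    measure_pmf.expectation D (\<lambda>X. measure_pmf.expectation (S h X)
      (\<lambda>Y. reach_prob (t - Suc s) (add_mset Y (graph_of G h)))))"
proof -
  have fin: "finite (set_pmf (S h X))" if "X \<in> set_pmf D" for h X
  proof (rule finite_subset)
    show "set_pmf (S h X) \<subseteq> X"
      using assms offers[OF that] by (auto simp: strategies_def)
  qed (rule finite_offer[OF that])
  have "measure_pmf.expectation (bind_pmf D (\<lambda>X. map_pmf (\<lambda>Y. h @ [(X, Y)]) (S h X)))
      (\<lambda>h. reach_prob (t - Suc s) (graph_of G h))
    = measure_pmf.expectation D (\<lambda>X. measure_pmf.expectation (S h X)
      (\<lambda>Y. reach_prob (t - Suc s) (add_mset Y (graph_of G h))))" for h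
    using fin finite_support by (subst expectation_bind_finite) (auto simp: graph_of_def)
  then show ?thesis
    unfolding chance_def play.simps
    using finite_play[OF assms] finite_support fin by (subst expectation_bind_finite) auto
qed

text \<open>Whatever law the strategy uses, the average over its choice is at most the maximum in
  the recursion.\<close>

lemma chance_Suc_le:
  assumes "S \<in> strategies n" "s < t"
  shows "chance S G t (Suc s) \<le> chance S G t s"
  unfolding chance_Suc[OF assms(1)]
proof (subst chance_def, rule expectation_mono_finite[OF finite_play[OF assms(1)]])
  fix h
  let ?H = "graph_of G h"
  have "measure_pmf.expectation (S h X) (\<lambda>Y. reach_prob (t - Suc s) (add_mset Y ?H))
      \<le> (MAX e\<in>X. reach_prob (t - Suc s) (add_mset e ?H))" if X: "X \<in> set_pmf D" for X
  proof -
    have sub: "set_pmf (S h X) \<subseteq> X"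
      using assms offers[OF X] by (auto simp: strategies_def)
    have "measure_pmf.expectation (S h X) (\<lambda>Y. reach_prob (t - Suc s) (add_mset Y ?H))
      \<le> measure_pmf.expectation (S h X) (\<lambda>Y. MAX e\<in>X. reach_prob (t - Suc s) (add_mset e ?H))"
      using sub finite_offer[OF X]
      by (intro expectation_mono_finite Max_ge) (auto intro: finite_subset)
    then show ?thesis
      by simp
  qed
  then have "measure_pmf.expectation D (\<lambda>X. measure_pmf.expectation (S h X)
      (\<lambda>Y. reach_prob (t - Suc s) (add_mset Y ?H))) \<le> reach_prob (Suc (t - Suc s)) ?H"
    unfolding reach_prob.simps by (intro expectation_mono_finite finite_support)
  then show "measure_pmf.expectation D (\<lambda>X. measure_pmf.expectation (S h X)
      (\<lambda>Y. reach_prob (t - Suc s) (add_mset Y ?H))) \<le> reach_prob (t - s) ?H"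
    using assms(2) by (simp only: Suc_diff_Suc)
qed

lemma prob_le_reach_prob:
  assumes "S \<in> strategies n"
  shows "measure_pmf.prob (play D S t) {h. graph_of G h \<in> A} \<le> reach_prob t G"
proof -
  have "s \<le> t \<Longrightarrow> chance S G t s \<le> reach_prob t G" for s
  proof (induction s)
    case (Suc s)
    then show ?case
      using chance_Suc_le[OF assms, of s t G] by simp
  qed (simp add: chance_0)
  then show ?thesis
    by (simp flip: chance_end)
qed

text \<open>Optimal for the fixed deadline \<open>t\<close> only; the number of steps left is read
  off the length of the history.\<close>

definition greedy :: "multigraph \<Rightarrow> nat \<Rightarrow> strategy" where
  "greedy G t h X = return_pmf (SOME Y. Y \<in> X \<and>
     reach_prob (t - Suc (length h)) (add_mset Y (graph_of G h)) =
       (MAX e\<in>X. reach_prob (t - Suc (length h)) (add_mset e (graph_of G h))))"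

lemma greedy_choice:
  assumes "X \<noteq> {}" "X \<subseteq> complete_edges n"
  obtains Y where "greedy G t h X = return_pmf Y" "Y \<in> X"
     "reach_prob (t - Suc (length h)) (add_mset Y (graph_of G h)) =
       (MAX e\<in>X. reach_prob (t - Suc (length h)) (add_mset e (graph_of G h)))"
proof -
  have "finite X"
    using assms(2) finite_E finite_subset by blast
  then have "(MAX e\<in>X. reach_prob (t - Suc (length h)) (add_mset e (graph_of G h)))
    \<in> (\<lambda>e. reach_prob (t - Suc (length h)) (add_mset e (graph_of G h))) ` X"
    using assms(1) by (intro Max_in) auto
  then have "\<exists>Y. Y \<in> X \<and> reach_prob (t - Suc (length h)) (add_mset Y (graph_of G h)) =
       (MAX e\<in>X. reach_prob (t - Suc (length h)) (add_mset e (graph_of G h)))"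
    by auto
  from someI_ex[OF this] show thesis
    using that unfolding greedy_def by blast
qed

lemma greedy_strategy: "greedy G t \<in> strategies n"
  unfolding strategies_def
proof clarify
  fix h X Y assume "X \<noteq> {}" "X \<subseteq> complete_edges n" "Y \<in> set_pmf (greedy G t h X)"
  then show "Y \<in> X"
    using greedy_choice[of X G t h] by (metis set_return_pmf singletonD)
qed

text \<open>The greedy choice attains the maximum in the recursion, so every inequality of the
  supermartingale argument becomes an equality.\<close>

lemma greedy_prob:
  "measure_pmf.prob (play D (greedy G t) t) {h. graph_of G h \<in> A} = reach_prob t G"
proof -
  have "s \<le> t \<Longrightarrow> chance (greedy G t) G t s = reach_prob t G" for s
  proof (induction s)
    case (Suc s)
    have "chance (greedy G t) G t (Suc s) = chance (greedy G t) G t s"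
      unfolding chance_Suc[OF greedy_strategy]
    proof (subst chance_def, rule expectation_cong_pmf)
      fix h assume "h \<in> set_pmf (play D (greedy G t) s)"
      then have [simp]: "length h = s"
        using play_rounds[OF greedy_strategy offers] by blast
      have "measure_pmf.expectation D (\<lambda>X. measure_pmf.expectation (greedy G t h X)
          (\<lambda>Y. reach_prob (t - Suc s) (add_mset Y (graph_of G h))))
        = reach_prob (Suc (t - Suc s)) (graph_of G h)"
        unfolding reach_prob.simps
      proof (rule expectation_cong_pmf)
        fix X assume "X \<in> set_pmf D"
        then obtain Y where "greedy G t h X = return_pmf Y"
          "reach_prob (t - Suc s) (add_mset Y (graph_of G h)) =
            (MAX e\<in>X. reach_prob (t - Suc s) (add_mset e (graph_of G h)))"
          using greedy_choice[of X G t h] offers by auto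
        then show "measure_pmf.expectation (greedy G t h X)
            (\<lambda>Y. reach_prob (t - Suc s) (add_mset Y (graph_of G h)))
          = (MAX e\<in>X. reach_prob (t - Suc s) (add_mset e (graph_of G h)))"
          by simp
      qed
      then show "measure_pmf.expectation D (\<lambda>X. measure_pmf.expectation (greedy G t h X)
          (\<lambda>Y. reach_prob (t - Suc s) (add_mset Y (graph_of G h))))
        = reach_prob (t - s) (graph_of G h)"
        using Suc.prems by (simp only: Suc_diff_Suc Suc_le_eq)
    qed
    then show ?case
      using Suc by simp
  qed (simp add: chance_0)
  then show ?thesis
    by (simp flip: chance_end)
qed

text \<open>Edges are only added, so having had the property at some time can be read off the final
  graph.\<close>

lemma graph_after_mono:
  assumes "set (map snd h) \<subseteq> complete_edges n" "graph_after G h i \<in> A"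
    "set_mset G \<subseteq> complete_edges n"
  shows "graph_of G h \<in> A"
proof (rule A_upward[OF assms(2)])
  have "mset (map snd h) = mset (map snd (take i h)) + mset (map snd (drop i h))"
    by (metis append_take_drop_id map_append mset_append)
  then show "graph_after G h i \<subseteq># graph_of G h"
    by (simp add: graph_after_def graph_of_def)
  show "set_mset (graph_of G h) \<subseteq> complete_edges n"
    using assms(1,3) by (auto simp: graph_of_def)
qed

lemma construct_prob_le:
  assumes "S \<in> strategies n" "set_mset G \<subseteq> complete_edges n"
  shows "construct_prob D S A G t \<le> reach_prob t G"
proof -
  have "construct_prob D S A G t \<le> measure_pmf.prob (play D S t) {h. graph_of G h \<in> A}"
    unfolding construct_prob_def
    using graph_after_mono[OF _ _ assms(2)] play_rounds[OF assms(1) offers]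
    by (intro measure_pmf.finite_measure_mono_AE) (auto simp: AE_measure_pmf_iff)
  then show ?thesis
    using prob_le_reach_prob[OF assms(1), of t G] by simp
qed

text \<open>Since \<open>T \<ge> 1\<close>, even an empty graph with the property is not hit within \<open>0\<close> steps.\<close>

definition max_hit_prob :: "nat \<Rightarrow> real" where
  "max_hit_prob t = (if t = 0 then 0 else reach_prob t {#})"

lemma hit_prob_0:
  assumes "S \<in> strategies n"
  shows "hit_prob D S A 0 = 0"
  by (simp add: hit_prob_def hitting_time_le_iff)

lemma hit_prob_pos:
  assumes "S \<in> strategies n" "0 < t"
  shows "hit_prob D S A t = measure_pmf.prob (play D S t) {h. graph_of {#} h \<in> A}"
proof -
  have "hitting_time A {#} h \<le> enat t \<longleftrightarrow> graph_of {#} h \<in> A" if "h \<in> set_pmf (play D S t)" for h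
  proof -
    have h: "length h = t" "set (map snd h) \<subseteq> complete_edges n"
      using play_rounds[OF assms(1) offers that] by auto
    have "graph_after {#} h t = graph_of {#} h"
      using h by (simp add: graph_after_def graph_of_def)
    then show ?thesis
      using graph_after_mono[OF h(2), of "{#}"] assms(2) h unfolding hitting_time_le_iff
      by (auto simp: Suc_le_eq intro!: exI[of _ t])
  qed
  then show ?thesis
    unfolding hit_prob_def
    by (intro measure_pmf.finite_measure_eq_AE) (auto simp: AE_measure_pmf_iff)
qed

lemma hit_prob_le_max: "S \<in> strategies n \<Longrightarrow> hit_prob D S A t \<le> max_hit_prob t"
  using prob_le_reach_prob hit_prob_0 hit_prob_pos by (cases "t = 0") (simp_all add: max_hit_prob_def)

lemma hit_prob_greedy: "hit_prob D (greedy {#} t) A t = max_hit_prob t"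
  using greedy_prob[of "{#}" t] hit_prob_0[OF greedy_strategy] hit_prob_pos[OF greedy_strategy]
  by (cases "t = 0") (simp_all add: max_hit_prob_def)

lemma max_hit_prob_mono: "t \<le> t' \<Longrightarrow> max_hit_prob t \<le> max_hit_prob t'"
  using reach_prob_mono_time[of t t' "{#}"] reach_prob_nonneg by (auto simp: max_hit_prob_def)

text \<open>Two phases: \<open>t\<close> steps of play with pretended edges, then
  \<open>K * k\<close> steps of repair, which fails with probability at most
  \<open>k * \<delta>\<close>.\<close>

lemma max_hit_prob_amplify:
  assumes replace: "\<And>G e. G \<in> A \<Longrightarrow> e \<in># G \<Longrightarrow>
      \<exists>S\<in>strategies n. 1 - \<delta> \<le> construct_prob D S A (G - {#e#}) K"
    and "0 \<le> \<delta>" "0 < L" "L \<le> 1/2" "0 < \<theta>" "\<theta> \<le> max_hit_prob t"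
  shows "1 - real k * \<delta> - tamper_budget L t \<theta> / (real k + 1) \<le> max_hit_prob (t + K * k)"
proof -
  have rep: "1 - \<delta> \<le> reach_prob K (G - {#e#})" if Ge: "G \<in> A" "e \<in># G" for G e
  proof -
    obtain S where S: "S \<in> strategies n" "1 - \<delta> \<le> construct_prob D S A (G - {#e#}) K"
      using replace[OF Ge] by blast
    have "set_mset (G - {#e#}) \<subseteq> complete_edges n"
      using A_edges[OF Ge(1)] by (meson in_diffD subset_iff)
    from construct_prob_le[OF S(1) this, of K] S(2) show ?thesis
      by linarith
  qed
  \<comment> \<open>\<open>t = 0\<close> is excluded because
    \<open>max_hit_prob 0 = 0 < \<theta>\<close>.\<close>
  have t: "0 < t" "\<theta> \<le> reach_prob t {#}"
    using assms(5,6) by (auto simp: max_hit_prob_def split: if_splits)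
  have "1 - real k * \<delta> - (real (size ({#} :: multigraph)) + tamper_budget L t (reach_prob t {#})) / (real k + 1)
      \<le> reach_prob (t + K * k) {#}"
  proof (rule reach_prob_tamper[where M = "{#}"])
    show "1 - real k * \<delta> \<le> reach_prob (K * k) R"
      if "F \<in> A" "F \<subseteq># R + M" "set_mset R \<subseteq> complete_edges n" "size M \<le> k" for F R M
      by (rule reach_prob_repair[OF rep \<open>0 \<le> \<delta>\<close> that])
  qed (use assms t in auto)
  moreover have "tamper_budget L t (reach_prob t {#}) \<le> tamper_budget L t \<theta>"
    using assms t unfolding tamper_budget_def by (intro mult_left_mono) auto
  then have "tamper_budget L t (reach_prob t {#}) / (real k + 1) \<le> tamper_budget L t \<theta> / (real k + 1)"
    by (intro divide_right_mono) auto
  ultimately show ?thesis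
    using t by (simp add: max_hit_prob_def)
qed

end

section \<open>Threshold times as levels of the best hitting probability\<close>

abbreviation best_prob :: "(nat \<Rightarrow> multigraph set) \<Rightarrow> (nat \<Rightarrow> edge set pmf) \<Rightarrow> nat \<Rightarrow> nat \<Rightarrow> real" where
  "best_prob P D n \<equiv> graph_game.max_hit_prob (D n) (P n)"

lemma graph_game_property:
  assumes "monotone_property P" "edge_set_distribution D" "2 \<le> n"
  shows "graph_game n (D n) (P n)"
proof
  show "finite (complete_edges n)"
    by (rule finite_subset[of _ "Pow {1..n}"]) (auto simp: complete_edges_def)
  show "X \<noteq> {} \<and> X \<subseteq> complete_edges n" if "X \<in> set_pmf (D n)" for X
    using assms(2,3) that by (auto simp: edge_set_distribution_def)
  show "set_mset G \<subseteq> complete_edges n" if "G \<in> P n" for G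
    using assms(1) that unfolding monotone_property_def multigraphs_def by blast
  show "H \<in> P n" if "G \<in> P n" "G \<subseteq># H" "set_mset H \<subseteq> complete_edges n" for G H
    using assms(1) that unfolding monotone_property_def multigraphs_def by blast
qed

context
  fixes P :: "nat \<Rightarrow> multigraph set" and D :: "nat \<Rightarrow> edge set pmf" and n :: nat
  assumes game: "graph_game n (D n) (P n)"
begin

interpretation graph_game n "D n" "P n"
  by (rule game)

text \<open>The greedy strategy attains the supremum over all strategies, so both quantifiers reduce
  to comparing \<open>\<theta>\<close> with one number.\<close>

lemma is_threshold_time_iff:
  "is_threshold_time P D \<theta> n t \<longleftrightarrow>
    1 \<le> t \<and> \<theta> \<le> best_prob P D n t \<and> best_prob P D n (t - 1) < \<theta>"
proof -
  have "(\<exists>S\<in>strategies n. \<theta> \<le> hit_prob (D n) S (P n) t) \<longleftrightarrow> \<theta> \<le> max_hit_prob t" for t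
    using hit_prob_le_max greedy_strategy hit_prob_greedy by (metis order_trans)
  moreover have "(\<forall>S\<in>strategies n. hit_prob (D n) S (P n) t < \<theta>) \<longleftrightarrow> max_hit_prob t < \<theta>" for t
    using hit_prob_le_max greedy_strategy hit_prob_greedy by (metis order_le_less_trans)
  ultimately show ?thesis
    by (simp add: is_threshold_time_def)
qed

text \<open>\<open>best_prob\<close> is nondecreasing in time, so the only threshold time is the
  first time at which it reaches \<open>\<theta>\<close>; the bound at \<open>t0\<close> ensures
  that there is one.\<close>

lemma threshold_time_le_iff:
  assumes "0 < \<theta>" "\<theta> \<le> best_prob P D n t0"
  shows "threshold_time P D \<theta> n \<le> t \<longleftrightarrow> \<theta> \<le> best_prob P D n t"
proof -
  define m where "m = (LEAST t. \<theta> \<le> max_hit_prob t)"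
  have m: "\<theta> \<le> max_hit_prob m"
    unfolding m_def using assms(2) by (rule LeastI)
  have iff: "m \<le> t \<longleftrightarrow> \<theta> \<le> max_hit_prob t" for t
    using m max_hit_prob_mono[of m t] Least_le[of "\<lambda>t. \<theta> \<le> max_hit_prob t" t]
    unfolding m_def by fastforce
  have "is_threshold_time P D \<theta> n t \<longleftrightarrow> t = m" for t
  proof -
    have "1 \<le> m"
      using m assms(1) by (cases m) (simp_all add: max_hit_prob_def)
    have "is_threshold_time P D \<theta> n t \<longleftrightarrow> 1 \<le> t \<and> m \<le> t \<and> \<not> m \<le> t - 1"
      unfolding is_threshold_time_iff iff by (simp add: not_le)
    then show ?thesis
      using \<open>1 \<le> m\<close> by linarith
  qed
  then have "threshold_time P D \<theta> n = m"
    by (simp add: threshold_time_def Least_equality)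
  then show ?thesis
    by (simp add: iff)
qed

lemma best_prob_amplify:
  assumes replace: "\<And>G e. G \<in> P n \<Longrightarrow> e \<in># G \<Longrightarrow>
      \<exists>S\<in>strategies n. 1 - \<delta> \<le> construct_prob (D n) S (P n) (G - {#e#}) K"
    and "0 \<le> \<delta>" "0 < \<theta>" "\<theta> \<le> best_prob P D n t" "t \<le> m"
  shows "1 - real k * \<delta> - (2 - 4 * ln \<theta>) * sqrt (real m) / (real k + 1) \<le> best_prob P D n (t + K * k)"
proof -
  \<comment> \<open>This balances the two parts of the budget:
    \<open>2 * L\<^sup>2 * t \<le> 1/2\<close> for \<open>t \<le> m\<close>, while
    \<open>2 / L = 4 * sqrt m\<close>.\<close>
  define L where "L = 1 / (2 * sqrt (real m))"
  have "1 \<le> t"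
    using assms(3,4) by (cases t) (simp_all add: max_hit_prob_def)
  then have m: "1 \<le> sqrt (real m)" "0 < m"
    using assms(5) by auto
  have L: "0 < L" "L \<le> 1/2"
    using m unfolding L_def by (auto simp: divide_simps)
  have sq: "2 * L\<^sup>2 = 1 / (2 * real m)" and inv: "2 / L = 4 * sqrt (real m)"
    using m by (simp_all add: L_def power_divide power_mult_distrib)
  have "2 * L\<^sup>2 * real t \<le> 1/2"
    unfolding sq using m assms(5) by (simp add: divide_simps)
  then have "tamper_budget L t \<theta> \<le> 4 * sqrt (real m) * (1/2 - ln \<theta>)"
    unfolding tamper_budget_def inv by (intro mult_left_mono) auto
  also have "\<dots> = (2 - 4 * ln \<theta>) * sqrt (real m)"
    by (simp add: algebra_simps)
  finally have "tamper_budget L t \<theta> / (real k + 1) \<le> (2 - 4 * ln \<theta>) * sqrt (real m) / (real k + 1)"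
    by (intro divide_right_mono) auto
  moreover have "1 - real k * \<delta> - tamper_budget L t \<theta> / (real k + 1) \<le> max_hit_prob (t + K * k)"
    by (rule max_hit_prob_amplify) (use assms L in auto)
  ultimately show ?thesis
    by linarith
qed

end

section \<open>Asymptotics and the sharp threshold\<close>

text \<open>Chosen so that \<open>k + 1 \<ge> C * sqrt m\<close> makes the Markov term of
  \<open>best_prob_amplify\<close> at most \<open>(1 - \<theta>') / 2\<close>.\<close>

definition gap_constant :: "real \<Rightarrow> real \<Rightarrow> real" where
  "gap_constant \<theta> \<theta>' = (4 - 8 * ln \<theta>) / (1 - \<theta>')"

lemma gap_constant_pos: "0 < \<theta> \<Longrightarrow> \<theta> \<le> 1/2 \<Longrightarrow> \<theta>' < 1 \<Longrightarrow> 0 < gap_constant \<theta> \<theta>'"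
  using ln_less_zero[of \<theta>] unfolding gap_constant_def by (intro divide_pos_pos) linarith+

context
  fixes P :: "nat \<Rightarrow> multigraph set" and D :: "nat \<Rightarrow> edge set pmf" and \<omega> :: "nat \<Rightarrow> real"
  assumes mono: "monotone_property P" and dist: "edge_set_distribution D"
    and median: "\<forall>\<^sub>F n in sequentially. \<exists>t. is_threshold_time P D (1/2) n t"
    and omega: "filterlim \<omega> at_top sequentially"
    and replaceable: "edge_replaceable P D \<omega>"
begin

lemma eventually_graph_game: "\<forall>\<^sub>F n in sequentially. graph_game n (D n) (P n)"
  using graph_game_property[OF mono dist] eventually_ge_at_top by (rule eventually_mono[rotated])

lemma eventually_best_prob_median:
  "\<forall>\<^sub>F n in sequentially. 1/2 \<le> best_prob P D n (median_time P D n)"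
  using eventually_graph_game median
proof eventually_elim
  case (elim n)
  then obtain t where "1/2 \<le> best_prob P D n t"
    using is_threshold_time_iff[of n D P] by blast
  then show ?case
    using threshold_time_le_iff[where P = P and D = D and n = n, OF elim(1), of "1/2" t "median_time P D n"] by simp
qed

text \<open>About \<open>C * sqrt m\<close> replacements of at most \<open>sqrt m / \<omega>\<close>
  steps take at most \<open>C * m / \<omega>\<close> steps. The allowed failure
  \<open>1 - \<theta>'\<close> is split evenly between too many pretended edges and failing
  replacements.\<close>

lemma eventually_gap:
  assumes "0 < \<theta>" "\<theta> \<le> 1/2" "\<theta>' < 1"
  shows "\<forall>\<^sub>F n in sequentially. \<forall>t\<le>median_time P D n. \<theta> \<le> best_prob P D n t \<longrightarrow>
    (\<exists>j. real j \<le> gap_constant \<theta> \<theta>' * (real (median_time P D n) / \<omega> n) \<and>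
         \<theta>' \<le> best_prob P D n (t + j))"
proof -
  let ?m = "median_time P D"
  let ?K = "\<lambda>n. nat \<lfloor>sqrt (real (?m n)) / \<omega> n\<rfloor>"
  define C where "C = gap_constant \<theta> \<theta>'"
  have "0 < C"
    unfolding C_def by (rule gap_constant_pos[OF assms])
  obtain \<delta> where small: "\<delta> \<in> o(\<lambda>n. 1 / sqrt (real (?m n)))"
    and replace: "\<forall>\<^sub>F n in sequentially. \<forall>G\<in>P n. \<forall>e\<in>set_mset G. \<exists>S\<in>strategies n.
           construct_prob (D n) S (P n) (G - {#e#}) (?K n) \<ge> 1 - \<delta> n"
    using replaceable unfolding edge_replaceable_def by blast
  \<comment> \<open>With this factor, \<open>C * sqrt m\<close> replacements fail with total
    probability at most \<open>(1 - \<theta>') / 2\<close>.\<close>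
  have "\<forall>\<^sub>F n in sequentially. norm (\<delta> n) \<le> (1 - \<theta>') / (2 * C) * norm (1 / sqrt (real (?m n)))"
    using assms \<open>0 < C\<close> by (intro landau_o.smallD[OF small]) auto
  moreover have "\<forall>\<^sub>F n in sequentially. 0 < \<omega> n"
    using omega by (auto simp: filterlim_at_top_dense)
  ultimately show ?thesis
    using eventually_graph_game replace
  proof eventually_elim
    case (elim n)
    show ?case
    proof (intro allI impI)
      fix t assume t: "t \<le> ?m n" "\<theta> \<le> best_prob P D n t"
      have "0 < t"
        using assms(1) t(2) by (cases t) (simp_all add: graph_game.max_hit_prob_def[OF elim(3)])
      then have m: "0 < sqrt (real (?m n))"
        using t(1) by simp
      define k where "k = nat \<lfloor>C * sqrt (real (?m n))\<rfloor>"
      have k: "real k \<le> C * sqrt (real (?m n))" "C * sqrt (real (?m n)) \<le> real k + 1"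
        using \<open>0 < C\<close> m unfolding k_def by (simp, linarith)
      have K: "real (?K n) \<le> sqrt (real (?m n)) / \<omega> n"
        using elim(2) by simp
      have "real (?K n * k) \<le> (sqrt (real (?m n)) / \<omega> n) * (C * sqrt (real (?m n)))"
        unfolding of_nat_mult using elim(2) by (intro mult_mono k K) auto
      also have "\<dots> = C * (real (?m n) / \<omega> n)"
        using real_sqrt_mult_self[of "real (?m n)"] by (simp add: mult_ac)
      finally have length: "real (?K n * k) \<le> C * (real (?m n) / \<omega> n)" .
      \<comment> \<open>\<open>\<delta> n\<close> may be negative, while
        \<open>best_prob_amplify\<close> asks for a nonnegative error; the absolute value only
        weakens the guarantee.\<close>
      have "1 - real k * \<bar>\<delta> n\<bar> - (2 - 4 * ln \<theta>) * sqrt (real (?m n)) / (real k + 1)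
          \<le> best_prob P D n (t + ?K n * k)"
      proof (rule best_prob_amplify[where P = P and D = D and n = n, OF elim(3)])
        fix G e assume "G \<in> P n" "e \<in># G"
        then obtain S where "S \<in> strategies n"
          "1 - \<delta> n \<le> construct_prob (D n) S (P n) (G - {#e#}) (?K n)"
          using elim(4) by blast
        then show "\<exists>S\<in>strategies n. 1 - \<bar>\<delta> n\<bar> \<le> construct_prob (D n) S (P n) (G - {#e#}) (?K n)"
          by (intro bexI[of _ S]) auto
      qed (use assms t in auto)
      moreover have "real k * \<bar>\<delta> n\<bar> \<le> (1 - \<theta>') / 2"
      proof -
        have "real k * \<bar>\<delta> n\<bar> \<le> (C * sqrt (real (?m n))) * ((1 - \<theta>') / (2 * C) * (1 / sqrt (real (?m n))))"
          using elim(1) \<open>0 < C\<close> m by (intro mult_mono k) auto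
        also have "\<dots> = (1 - \<theta>') / 2"
          using \<open>0 < C\<close> m by simp
        finally show ?thesis .
      qed
      moreover have "(2 - 4 * ln \<theta>) * sqrt (real (?m n)) / (real k + 1) \<le> (1 - \<theta>') / 2"
      proof -
        have "(1 - \<theta>') * C = 4 - 8 * ln \<theta>"
          using assms(3) by (simp add: C_def gap_constant_def)
        then have "(2 - 4 * ln \<theta>) * sqrt (real (?m n)) = ((1 - \<theta>') * C) / 2 * sqrt (real (?m n))"
          by simp
        also have "\<dots> = (1 - \<theta>') / 2 * (C * sqrt (real (?m n)))"
          by simp
        also have "\<dots> \<le> (1 - \<theta>') / 2 * (real k + 1)"
          using assms(3) by (intro mult_left_mono k) auto
        finally show ?thesis
          by (simp add: divide_le_eq)
      qed
      ultimately have "\<theta>' \<le> best_prob P D n (t + ?K n * k)"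
        by argo
      then show "\<exists>j. real j \<le> gap_constant \<theta> \<theta>' * (real (?m n) / \<omega> n) \<and> \<theta>' \<le> best_prob P D n (t + j)"
        using length unfolding C_def by blast
    qed
  qed
qed

lemma eventually_threshold_gap:
  assumes "0 < \<theta>1" "\<theta>1 < \<theta>2" "\<theta>2 < 1"
  shows "\<forall>\<^sub>F n in sequentially.
    \<bar>real (threshold_time P D \<theta>2 n) - real (threshold_time P D \<theta>1 n)\<bar>
      \<le> gap_constant (min \<theta>1 (1/2)) \<theta>2 * (real (median_time P D n) / \<omega> n)"
proof -
  \<comment> \<open>\<open>eventually_gap\<close> starts at times up to the median, so the starting
    level is lowered to at most \<open>1/2\<close>. Both thresholds then lie between
    \<open>?t \<theta>\<close> and \<open>?t \<theta> + j\<close>.\<close>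
  define \<theta> where "\<theta> = min \<theta>1 (1/2)"
  have \<theta>: "0 < \<theta>" "\<theta> \<le> 1/2" "\<theta> \<le> \<theta>1"
    using assms by (auto simp: \<theta>_def)
  show ?thesis
    using eventually_graph_game eventually_best_prob_median eventually_gap[OF \<theta>(1,2) assms(3)]
    unfolding \<theta>_def[symmetric]
  proof eventually_elim
    case (elim n)
    let ?t = "\<lambda>\<theta>. threshold_time P D \<theta> n"
    have le_iff: "?t x \<le> t \<longleftrightarrow> x \<le> best_prob P D n t" if "0 < x" "x \<le> best_prob P D n t0" for x t t0
      using threshold_time_le_iff[where P = P and D = D and n = n, OF elim(1) that] .
    have "\<theta> \<le> best_prob P D n (median_time P D n)"
      using \<theta>(2) elim(2) by linarith
    note low = le_iff[OF \<theta>(1) this]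
    have "?t \<theta> \<le> median_time P D n" "\<theta> \<le> best_prob P D n (?t \<theta>)"
      using low \<open>\<theta> \<le> best_prob P D n (median_time P D n)\<close> by blast+
    then obtain j where j: "real j \<le> gap_constant \<theta> \<theta>2 * (real (median_time P D n) / \<omega> n)"
      "\<theta>2 \<le> best_prob P D n (?t \<theta> + j)"
      using elim(3) by blast
    have pos: "0 < \<theta>2" and le: "\<theta>1 \<le> best_prob P D n (?t \<theta> + j)"
      using assms j(2) by linarith+
    note high = le_iff[OF pos j(2)] and mid = le_iff[OF assms(1) le]
    have "?t \<theta>2 \<le> ?t \<theta> + j"
      using high j(2) by blast
    moreover have "?t \<theta>1 \<le> ?t \<theta>2"
      using mid high[of "?t \<theta>2"] assms(2) by auto
    moreover have "?t \<theta> \<le> ?t \<theta>1"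
      using low mid[of "?t \<theta>1"] \<theta>(3) by auto
    ultimately show ?case
      using j(1) by linarith
  qed
qed

text \<open>As \<open>\<omega>\<close> tends to infinity, \<open>C / \<omega>\<close> drops below
  \<open>\<epsilon>\<close>. The strict inequality, which needs a positive median, gives the
  contradiction in the lower bound.\<close>

lemma eventually_gap_small:
  assumes "0 < \<theta>" "\<theta> \<le> 1/2" "\<theta>' < 1" "0 < \<epsilon>"
  shows "\<forall>\<^sub>F n in sequentially. \<forall>t\<le>median_time P D n. \<theta> \<le> best_prob P D n t \<longrightarrow>
    (\<exists>j. real j < \<epsilon> * real (median_time P D n) \<and> \<theta>' \<le> best_prob P D n (t + j))"
proof -
  let ?C = "gap_constant \<theta> \<theta>'"
  have "0 < ?C"
    by (rule gap_constant_pos[OF assms(1-3)])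
  have "\<forall>\<^sub>F n in sequentially. ?C / \<epsilon> < \<omega> n"
    using omega by (auto simp: filterlim_at_top_dense)
  then show ?thesis
    using eventually_gap[OF assms(1-3)] eventually_graph_game
  proof eventually_elim
    case (elim n)
    have "0 < \<omega> n"
      using elim(1) \<open>0 < ?C\<close> assms(4) by (meson divide_pos_pos less_trans)
    then have "?C / \<omega> n < \<epsilon>"
      using elim(1) assms(4) by (simp add: field_simps)
    show ?case
    proof (intro allI impI)
      fix t assume t: "t \<le> median_time P D n" "\<theta> \<le> best_prob P D n t"
      have "0 < t"
        using assms(1) t(2) by (cases t) (simp_all add: graph_game.max_hit_prob_def[OF elim(3)])
      then have "?C / \<omega> n * real (median_time P D n) < \<epsilon> * real (median_time P D n)"
        using t(1) \<open>?C / \<omega> n < \<epsilon>\<close> by (intro mult_strict_right_mono) auto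
      moreover obtain j where "real j \<le> ?C * (real (median_time P D n) / \<omega> n)"
        "\<theta>' \<le> best_prob P D n (t + j)"
        using elim(2) t by blast
      ultimately show "\<exists>j. real j < \<epsilon> * real (median_time P D n) \<and> \<theta>' \<le> best_prob P D n (t + j)"
        by (intro exI[of _ j]) auto
    qed
  qed
qed

lemma sharp_threshold_upper:
  assumes "0 < \<epsilon>"
  shows "\<exists>S. (\<forall>n. S n \<in> strategies n) \<and>
    (\<lambda>n. hit_prob (D n) (S n) (P n) (nat \<lfloor>(1 + \<epsilon>) * real (median_time P D n)\<rfloor>)) \<longlonglongrightarrow> 1"
proof -
  define t where "t n = nat \<lfloor>(1 + \<epsilon>) * real (median_time P D n)\<rfloor>" for n
  have "\<exists>S\<in>strategies n. graph_game n (D n) (P n) \<longrightarrow> hit_prob (D n) S (P n) (t n) = best_prob P D n (t n)" for n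
  proof (cases "graph_game n (D n) (P n)")
    case True
    then show ?thesis
      using graph_game.greedy_strategy graph_game.hit_prob_greedy by blast
  next
    case False
    \<comment> \<open>A default for the finitely many \<open>n\<close> where the game may be
      undefined.\<close>
    have "(\<lambda>h X. return_pmf (SOME Y. Y \<in> X)) \<in> strategies n"
      by (auto simp: strategies_def some_in_eq)
    then show ?thesis
      using False by blast
  qed
  then obtain S where S: "\<And>n. S n \<in> strategies n"
    "\<And>n. graph_game n (D n) (P n) \<Longrightarrow> hit_prob (D n) (S n) (P n) (t n) = best_prob P D n (t n)"
    by metis
  have "(\<lambda>n. hit_prob (D n) (S n) (P n) (t n)) \<longlonglongrightarrow> 1"
  proof (rule order_tendstoI)
    fix a :: real assume "1 < a"
    then show "\<forall>\<^sub>F n in sequentially. hit_prob (D n) (S n) (P n) (t n) < a"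
      unfolding hit_prob_def by (meson always_eventually le_less_trans measure_pmf.prob_le_1)
  next
    fix a :: real assume "a < 1"
    then have "(a + 1) / 2 < 1" "a < (a + 1) / 2"
      by auto
    \<comment> \<open>The gap is applied at the median itself, from level \<open>1/2\<close> to a
      level strictly between \<open>a\<close> and 1.\<close>
    have half: "0 < (1/2 :: real)" "(1/2 :: real) \<le> 1/2"
      by auto
    show "\<forall>\<^sub>F n in sequentially. a < hit_prob (D n) (S n) (P n) (t n)"
      using eventually_graph_game eventually_best_prob_median
        eventually_gap_small[OF half \<open>(a + 1) / 2 < 1\<close> assms]
    proof eventually_elim
      case (elim n)
      then obtain j where j: "real j < \<epsilon> * real (median_time P D n)"
        "(a + 1) / 2 \<le> best_prob P D n (median_time P D n + j)"
        by blast
      have "median_time P D n + j \<le> t n"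
        unfolding t_def using j(1) by (intro le_nat_floor) (simp add: algebra_simps)
      then have "best_prob P D n (median_time P D n + j) \<le> best_prob P D n (t n)"
        by (rule graph_game.max_hit_prob_mono[OF elim(1)])
      then show ?case
        using S(2)[OF elim(1)] j(2) \<open>a < (a + 1) / 2\<close> by linarith
    qed
  qed
  then show ?thesis
    using S(1) unfolding t_def by blast
qed

text \<open>A chance \<open>\<theta>\<close> by time \<open>(1 - \<epsilon>) * m\<close> would grow
  to \<open>1/2\<close> in fewer than \<open>\<epsilon> * m\<close> further steps, hence before the
  median.\<close>

lemma sharp_threshold_lower:
  assumes "0 < \<epsilon>" "\<And>n. S n \<in> strategies n"
  shows "(\<lambda>n. hit_prob (D n) (S n) (P n) (nat \<lfloor>(1 - \<epsilon>) * real (median_time P D n)\<rfloor>)) \<longlonglongrightarrow> 0"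
proof (rule order_tendstoI)
  fix a :: real assume "a < 0"
  then show "\<forall>\<^sub>F n in sequentially.
      a < hit_prob (D n) (S n) (P n) (nat \<lfloor>(1 - \<epsilon>) * real (median_time P D n)\<rfloor>)"
    unfolding hit_prob_def by (meson always_eventually less_le_trans measure_nonneg)
next
  fix a :: real assume "0 < a"
  define \<theta> where "\<theta> = min (a / 2) (1/2)"
  have \<theta>: "0 < \<theta>" "\<theta> \<le> 1/2" "\<theta> < a"
    using \<open>0 < a\<close> by (auto simp: \<theta>_def)
  have "(1/2 :: real) < 1"
    by simp
  show "\<forall>\<^sub>F n in sequentially.
      hit_prob (D n) (S n) (P n) (nat \<lfloor>(1 - \<epsilon>) * real (median_time P D n)\<rfloor>) < a"
    using eventually_graph_game eventually_best_prob_median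
      eventually_gap_small[OF \<theta>(1,2) \<open>1/2 < 1\<close> assms(1)]
  proof eventually_elim
    case (elim n)
    define t where "t = nat \<lfloor>(1 - \<epsilon>) * real (median_time P D n)\<rfloor>"
    have "\<not> \<theta> \<le> best_prob P D n t"
    proof
      assume "\<theta> \<le> best_prob P D n t"
      \<comment> \<open>For \<open>\<epsilon> \<ge> 1\<close>, \<open>nat\<close> cuts the time off
        at 0, where the best probability is 0; a positive \<open>t\<close> is a genuine
        floor.\<close>
      then have "0 < t"
        using \<theta>(1) by (cases t) (simp_all add: graph_game.max_hit_prob_def[OF elim(1)])
      then have t: "real t \<le> (1 - \<epsilon>) * real (median_time P D n)"
        unfolding t_def by linarith
      also have "\<dots> \<le> real (median_time P D n)"
        using assms(1) by (simp add: left_diff_distrib)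
      finally obtain j where j: "real j < \<epsilon> * real (median_time P D n)" "1/2 \<le> best_prob P D n (t + j)"
        using elim(3) \<open>\<theta> \<le> best_prob P D n t\<close> by auto
      have "median_time P D n \<le> t + j"
        using threshold_time_le_iff[where P = P and D = D and n = n, OF elim(1) _ elim(2)] j(2) by simp
      then show False
        using t j(1) by (simp add: left_diff_distrib)
    qed
    then show ?case
      using graph_game.hit_prob_le_max[OF elim(1) assms(2), of t] \<theta>(3) unfolding t_def by linarith
  qed
qed

lemma sharp_threshold_median: "sharp_threshold P D (\<lambda>n. real (median_time P D n))"
  unfolding sharp_threshold_def using sharp_threshold_upper sharp_threshold_lower by blast

end

theorem theorem1p1:
  shows "\<exists>C :: real \<Rightarrow> real \<Rightarrow> real.
    \<forall>(P :: nat \<Rightarrow> multigraph set) (D :: nat \<Rightarrow> edge set pmf) (\<omega> :: nat \<Rightarrow> real).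
      monotone_property P \<longrightarrow>
      edge_set_distribution D \<longrightarrow>
      (\<forall>\<^sub>F n in sequentially. \<exists>t. is_threshold_time P D (1/2) n t) \<longrightarrow>
      filterlim \<omega> at_top sequentially \<longrightarrow>
      edge_replaceable P D \<omega> \<longrightarrow>
      (\<forall>\<theta>1 \<theta>2. 0 < \<theta>1 \<longrightarrow> \<theta>1 < \<theta>2 \<longrightarrow> \<theta>2 < 1 \<longrightarrow>
         (\<forall>\<^sub>F n in sequentially.
            \<bar>real (threshold_time P D \<theta>2 n) - real (threshold_time P D \<theta>1 n)\<bar>
              \<le> C \<theta>1 \<theta>2 * (real (median_time P D n) / \<omega> n))) \<and>
      sharp_threshold P D (\<lambda>n. real (median_time P D n))"
  using eventually_threshold_gap sharp_threshold_median
  \<comment> \<open>The witness is built from the two levels alone, so it can be fixed before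
    \<open>P\<close>, \<open>D\<close> and \<open>\<omega>\<close>.\<close>
  by (intro exI[of _ "\<lambda>\<theta>1. gap_constant (min \<theta>1 (1/2))"] allI impI conjI)

end
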